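(* Let $\Gamma$ be a non-empty set, let $Y$ be a Banach space over $\mathbb{K}$, let $C\subset S_{Y^*}$ be such that $B_{Y^*}=\overline{\operatorname{conv}}^{w^*}(C)$, and let $f,g\in\ell_\infty(\Gamma,Y)$. Then $f\perp_B g$ in $\ell_\infty(\Gamma,Y)$ if and only if $$0\in\operatorname{conv}\{\lim y_n^*(g(\gamma_n))\colon \gamma_n\in\Gamma,\ y_n^*\in C\ \forall n\in\mathbb{N},\ \lim y_n^*(f(\gamma_n))=\|f\|\}.$$
   Context: $\mathbb{K}$ is $\mathbb{R}$ or $\mathbb{C}$. $\ell_\infty(\Gamma,Y)$ is the Banach space of all bounded functions from $\Gamma$ to $Y$ with the supremum norm. $B_{Y^*}$ and $S_{Y^*}$ are the closed unit ball and unit sphere of the dual $Y^*$; $\overline{\operatorname{conv}}^{w^*}$ is the weak-star closed convex hull and $\operatorname{conv}$ the convex hull. $x\perp_B y$ (Birkhoff-James orthogonality) means $\|x+\lambda y\|\geq\|x\|$ for all $\lambda\in\mathbb{K}$. Writing $\lim a_n$ for a bounded scalar sequence means that the sequence is required to be convergent. *)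

theory Defs
  imports "HOL-Analysis.Analysis" "HOL-Library.Function_Algebras"
begin

text \<open>The scalar field \<open>K\<close> is a type isometrically isomorphic, as a real normed field, to
  the reals or to the complex numbers. The isomorphisms are spelled out because a class
  specification cannot mention constants such as \<^const>\<open>linear\<close> that are constrained by a class
  on the class parameter.\<close>

class real_or_complex = real_normed_field +
  assumes iso_real_or_complex:
    "(\<exists>h :: 'a \<Rightarrow> real. bij h \<and> h 1 = 1
        \<and> (\<forall>x y. h (x + y) = h x + h y) \<and> (\<forall>x y. h (x * y) = h x * h y)
        \<and> (\<forall>r x. h (r *\<^sub>R x) = r *\<^sub>R h x) \<and> (\<forall>x. norm (h x) = norm x))
     \<or> (\<exists>h :: 'a \<Rightarrow> complex. bij h \<and> h 1 = 1
        \<and> (\<forall>x y. h (x + y) = h x + h y) \<and> (\<forall>x y. h (x * y) = h x * h y)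
        \<and> (\<forall>r x. h (r *\<^sub>R x) = r *\<^sub>R h x) \<and> (\<forall>x. norm (h x) = norm x))"

instance real :: real_or_complex
  by standard (rule disjI1, rule exI[of _ "\<lambda>x. x"], auto simp: bij_def inj_on_def)

instance complex :: real_or_complex
  by standard (rule disjI2, rule exI[of _ "\<lambda>x. x"], auto simp: bij_def inj_on_def)

text \<open>A Banach space over \<open>K\<close>: completeness and the norm come from the class \<^class>\<open>banach\<close>, whose
  real scalar multiplication is required to be the restriction of the one by \<open>K\<close>.\<close>

locale banach_space_over = vector_space smul
  for smul :: "'k::real_or_complex \<Rightarrow> 'y::banach \<Rightarrow> 'y" +
  assumes smul_of_real: "smul (of_real r) y = r *\<^sub>R y"
    and norm_smul: "norm (smul c y) = norm c * norm y"

text \<open>The type \<open>'y \<Rightarrow>\<^sub>L 'k\<close> consists of the bounded real-linear maps; the dual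
  space is its subspace of \<open>K\<close>-linear maps, with the same (operator) norm.\<close>

definition dual_space ::
  "('k::real_or_complex \<Rightarrow> 'y::real_normed_vector \<Rightarrow> 'y) \<Rightarrow> ('y \<Rightarrow>\<^sub>L 'k) set"
  where "dual_space smul =
    {\<phi>. \<forall>c y. blinfun_apply \<phi> (smul c y) = c * blinfun_apply \<phi> y}"

definition dual_ball ::
  "('k::real_or_complex \<Rightarrow> 'y::real_normed_vector \<Rightarrow> 'y) \<Rightarrow> ('y \<Rightarrow>\<^sub>L 'k) set"
  where "dual_ball smul = dual_space smul \<inter> cball 0 1"

definition dual_sphere ::
  "('k::real_or_complex \<Rightarrow> 'y::real_normed_vector \<Rightarrow> 'y) \<Rightarrow> ('y \<Rightarrow>\<^sub>L 'k) set"
  where "dual_sphere smul = dual_space smul \<inter> sphere 0 1"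

text \<open>The topology on \<open>'y \<Rightarrow> 'k\<close> that is pulled back here is the product topology, so this is the
  topology of pointwise convergence on the dual space.\<close>

definition weak_star_topology ::
  "('k::real_or_complex \<Rightarrow> 'y::real_normed_vector \<Rightarrow> 'y) \<Rightarrow> ('y \<Rightarrow>\<^sub>L 'k) topology"
  where "weak_star_topology smul = pullback_topology (dual_space smul) blinfun_apply euclidean"

text \<open>Elements of \<open>\<ell>\<^sub>\<infinity>(\<Gamma>, Y)\<close> are represented by functions on the ambient type of \<open>\<Gamma>\<close>; their
  values outside \<open>\<Gamma>\<close> are irrelevant for membership and for the norm.\<close>

definition linf :: "'g set \<Rightarrow> ('g \<Rightarrow> 'y::real_normed_vector) set"
  where "linf \<Gamma> = {f. bounded (f ` \<Gamma>)}"

definition linf_norm :: "'g set \<Rightarrow> ('g \<Rightarrow> 'y::real_normed_vector) \<Rightarrow> real"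
  where "linf_norm \<Gamma> f = (SUP \<gamma>\<in>\<Gamma>. norm (f \<gamma>))"

definition linf_smul :: "('k \<Rightarrow> 'y \<Rightarrow> 'y) \<Rightarrow> 'k \<Rightarrow> ('g \<Rightarrow> 'y) \<Rightarrow> 'g \<Rightarrow> 'y"
  where "linf_smul smul c f = (\<lambda>\<gamma>. smul c (f \<gamma>))"

text \<open>Birkhoff--James orthogonality with respect to the norm \<open>N\<close> and the scalar multiplication
  \<open>s\<close>. For functions, \<open>+\<close> is pointwise addition from \<^theory>\<open>HOL-Library.Function_Algebras\<close>.\<close>

definition birkhoff_james_orthogonal ::
  "('v::plus \<Rightarrow> real) \<Rightarrow> ('k \<Rightarrow> 'v \<Rightarrow> 'v) \<Rightarrow> 'v \<Rightarrow> 'v \<Rightarrow> bool"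
  where "birkhoff_james_orthogonal N s x y \<longleftrightarrow> (\<forall>c. N (x + s c y) \<ge> N x)"

end

theory Submission
  imports Defs
begin

text \<open>Separating the weak-star closed convex hull of \<open>C\<close> from a norming functional (Hahn--Banach)
  shows that \<open>C\<close> is norming: \<open>\<parallel>y\<parallel> = sup {Re \<phi>(y) | \<phi> \<in> C}\<close>. Let \<open>D\<close> be the set of limits in
  the theorem; it is compact, hence so is its convex hull. If \<open>f \<bottom> g\<close>, then for every scalar \<open>c\<close>
  one can pick \<open>\<gamma>\<^sub>n\<close> and \<open>\<phi>\<^sub>n \<in> C\<close> with \<open>Re \<phi>\<^sub>n((f + n\<^sup>-\<^sup>1 c g)(\<gamma>\<^sub>n)) > \<parallel>f\<parallel> - n\<^sup>-\<^sup>2\<close>; then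
  \<open>\<phi>\<^sub>n(f(\<gamma>\<^sub>n))\<close> tends to \<open>\<parallel>f\<parallel>\<close> while \<open>Re (c \<phi>\<^sub>n(g(\<gamma>\<^sub>n))) > -n\<^sup>-\<^sup>1\<close>, so \<open>D\<close> meets every closed
  half-plane \<open>Re (c z) \<ge> 0\<close> and \<open>0\<close> cannot be separated from its convex hull. Conversely, the
  closed half-plane \<open>\<parallel>f\<parallel> + Re (c z) \<le> \<parallel>f + c g\<parallel>\<close> contains \<open>D\<close>, hence also \<open>0\<close>.\<close>

subsection \<open>Hahn--Banach by minimal sublinear functionals\<close>

text \<open>Only \<open>\<le>\<close> is required in the homogeneity condition; the equality follows.\<close>

definition sublinear_functional :: "('a::real_vector \<Rightarrow> real) \<Rightarrow> bool"
  where "sublinear_functional p \<longleftrightarrow>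
    (\<forall>x y. p (x + y) \<le> p x + p y) \<and> (\<forall>r x. 0 \<le> r \<longrightarrow> p (r *\<^sub>R x) \<le> r * p x)"

lemma sublinear_functionalI:
  assumes "\<And>x y. p (x + y) \<le> p x + p y" and "\<And>r x. 0 \<le> r \<Longrightarrow> p (r *\<^sub>R x) \<le> r * p x"
  shows "sublinear_functional p"
  using assms by (simp add: sublinear_functional_def)

lemma sublinear_functional_add: "sublinear_functional p \<Longrightarrow> p (x + y) \<le> p x + p y"
  and sublinear_functional_scale: "sublinear_functional p \<Longrightarrow> 0 \<le> r \<Longrightarrow> p (r *\<^sub>R x) \<le> r * p x"
  by (simp_all add: sublinear_functional_def)

lemma sublinear_functional_0: "sublinear_functional p \<Longrightarrow> p 0 = 0"
  using sublinear_functional_add[of p 0 0] sublinear_functional_scale[of p 0 0] by simp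

lemma sublinear_functional_minus: "sublinear_functional p \<Longrightarrow> - p (- x) \<le> p x"
  using sublinear_functional_add[of p x "- x"] sublinear_functional_0[of p] by simp

lemma sublinear_functional_norm: "sublinear_functional norm"
  by (rule sublinear_functionalI) (auto simp: norm_triangle_ineq)

text \<open>Scaling \<open>r *\<^sub>R x\<close> back by \<open>inverse r\<close> turns the upper
  bound for the factor \<open>inverse r\<close> into a lower one for \<open>r\<close>; together the
  two bounds give positive homogeneity.\<close>

lemma sublinear_functional_scale_ge:
  assumes "sublinear_functional p" "0 \<le> r"
  shows "r * p x \<le> p (r *\<^sub>R x)"
proof (cases "r = 0")
  case False
  then have "p x \<le> inverse r * p (r *\<^sub>R x)"
    using sublinear_functional_scale[OF assms(1), of "inverse r" "r *\<^sub>R x"] assms(2) by simp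
  then show ?thesis
    using False assms(2) by (simp add: field_simps)
qed (simp add: sublinear_functional_0[OF assms(1)])

text \<open>Lowering \<open>p\<close> along the ray through \<open>y\<close>: the infimum defining
  \<open>q\<close> gives \<open>q \<le> p\<close> at \<open>t = 0\<close>, and at the point
  \<open>- y\<close> with \<open>t = 1\<close> it gives \<open>p 0 - p y = - p y\<close>. Iterating
  such reductions to a minimal functional will force oddness.\<close>

lemma sublinear_functional_below:
  fixes p :: "'a::real_vector \<Rightarrow> real"
  assumes p: "sublinear_functional p"
  obtains q where "sublinear_functional q" "q \<le> p" "q (- y) \<le> - p y"
proof -
  define q where "q = (\<lambda>x. INF t\<in>{0..}. p (x + t *\<^sub>R y) - t * p y)"
  have bdd: "bdd_below ((\<lambda>t. p (x + t *\<^sub>R y) - t * p y) ` {0..})" for x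
  proof (rule bdd_belowI2)
    fix t :: real assume "t \<in> {0..}"
    then have "t * p y \<le> p (t *\<^sub>R y)"
      using sublinear_functional_scale_ge[OF p] by simp
    also have "\<dots> \<le> p (x + t *\<^sub>R y) + p (- x)"
      using sublinear_functional_add[OF p, of "x + t *\<^sub>R y" "- x"] by simp
    finally show "- p (- x) \<le> p (x + t *\<^sub>R y) - t * p y"
      by simp
  qed
  have q_le: "q x \<le> p (x + t *\<^sub>R y) - t * p y" if "0 \<le> t" for t x
    unfolding q_def using that by (intro cINF_lower bdd) auto
  have le_q: "m \<le> q x" if "\<And>t. 0 \<le> t \<Longrightarrow> m \<le> p (x + t *\<^sub>R y) - t * p y" for m x
    unfolding q_def using that by (intro cINF_greatest) auto
  have "sublinear_functional q"
  proof (rule sublinear_functionalI)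
    fix x1 x2
    \<comment> \<open>The two infima have independent parameters \<open>s\<close> and
      \<open>t\<close>; their sum is the parameter used at \<open>x1 + x2\<close>.\<close>
    have "q (x1 + x2) - (p (x1 + s *\<^sub>R y) - s * p y) \<le> p (x2 + t *\<^sub>R y) - t * p y"
      if "0 \<le> s" "0 \<le> t" for s t
      using q_le[of "s + t" "x1 + x2"] that
        sublinear_functional_add[OF p, of "x1 + s *\<^sub>R y" "x2 + t *\<^sub>R y"]
      by (simp add: algebra_simps)
    then have "q (x1 + x2) - (p (x1 + s *\<^sub>R y) - s * p y) \<le> q x2" if "0 \<le> s" for s
      using that by (intro le_q) auto
    then have "q (x1 + x2) - q x2 \<le> q x1"
      by (intro le_q) (simp add: algebra_simps)
    then show "q (x1 + x2) \<le> q x1 + q x2"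
      by simp
  next
    fix r :: real and x assume r: "0 \<le> r"
    show "q (r *\<^sub>R x) \<le> r * q x"
    proof (cases "r = 0")
      case True
      then show ?thesis
        using q_le[of 0 0] sublinear_functional_0[OF p] by simp
    next
      case False
      have "q (r *\<^sub>R x) \<le> r * (p (x + t *\<^sub>R y) - t * p y)" if "0 \<le> t" for t
        using q_le[of "r * t" "r *\<^sub>R x"] r that sublinear_functional_scale[OF p r, of "x + t *\<^sub>R y"]
        by (simp add: algebra_simps)
      then have "inverse r * q (r *\<^sub>R x) \<le> q x"
        using r False by (intro le_q) (simp add: field_simps)
      then show ?thesis
        using r False by (simp add: field_simps)
    qed
  qed
  moreover have "q \<le> p"
    using q_le[of 0] by (auto intro!: le_funI)
  moreover have "q (- y) \<le> - p y"
    using q_le[of 1 "- y"] sublinear_functional_0[OF p] by simp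
  ultimately show thesis
    using that by blast
qed

text \<open>Subadditivity survives because, of two members of a chain, the smaller one bounds both
  terms: if \<open>p \<le> q\<close>, then \<open>p (x + y) \<le> p x + p y \<le> p x + q y\<close>.
  This supplies the lower bounds of chains for Zorn's lemma.\<close>

lemma sublinear_functional_INF:
  fixes \<A> :: "('a::real_vector \<Rightarrow> real) set"
  assumes ne: "\<A> \<noteq> {}" and sub: "\<And>p. p \<in> \<A> \<Longrightarrow> sublinear_functional p"
    and bdd: "\<And>x. bdd_below ((\<lambda>p. p x) ` \<A>)"
    and chain: "\<And>p q. p \<in> \<A> \<Longrightarrow> q \<in> \<A> \<Longrightarrow> p \<le> q \<or> q \<le> p"
  shows "sublinear_functional (\<lambda>x. INF p\<in>\<A>. p x)"
proof (rule sublinear_functionalI)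
  define u where "u = (\<lambda>x. INF p\<in>\<A>. p x)"
  have u_le: "u x \<le> p x" if "p \<in> \<A>" for p x
    unfolding u_def using that by (intro cINF_lower bdd)
  have le_u: "m \<le> u x" if "\<And>p. p \<in> \<A> \<Longrightarrow> m \<le> p x" for m x
    unfolding u_def using that ne by (intro cINF_greatest) auto
  fix x y
  have pq: "u (x + y) - p x \<le> q y" if "p \<in> \<A>" "q \<in> \<A>" for p q
    using chain[OF that] u_le[OF that(1), of "x + y"] u_le[OF that(2), of "x + y"]
      sublinear_functional_add[OF sub[OF that(1)], of x y]
      sublinear_functional_add[OF sub[OF that(2)], of x y]
    by (smt (verit) le_funD)
  have "u (x + y) - u y \<le> u x"
  proof (rule le_u)
    fix p assume "p \<in> \<A>"
    then have "u (x + y) - p x \<le> u y"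
      by (intro le_u pq)
    then show "u (x + y) - u y \<le> p x"
      by simp
  qed
  then show "(INF p\<in>\<A>. p (x + y)) \<le> (INF p\<in>\<A>. p x) + (INF p\<in>\<A>. p y)"
    by (simp add: u_def)
next
  fix r :: real and x :: 'a assume r: "0 \<le> r"
  have le: "(INF p\<in>\<A>. p (r *\<^sub>R x)) \<le> r * p x" if "p \<in> \<A>" for p
    using cINF_lower[OF bdd[of "r *\<^sub>R x"] that] sublinear_functional_scale[OF sub[OF that] r, of x]
    by linarith
  show "(INF p\<in>\<A>. p (r *\<^sub>R x)) \<le> r * (INF p\<in>\<A>. p x)"
  proof (cases "r = 0")
    case True
    then show ?thesis
      using le ne by force
  next
    case False
    then have "inverse r * (INF p\<in>\<A>. p (r *\<^sub>R x)) \<le> (INF p\<in>\<A>. p x)"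
      using ne r le by (intro cINF_greatest) (auto simp: field_simps)
    then show ?thesis
      using r False by (simp add: field_simps)
  qed
qed

text \<open>By Zorn's lemma there is a minimal sublinear functional below \<open>p\<close>.
  Minimality makes it odd, and an odd sublinear functional is linear.\<close>

theorem linear_below_sublinear_functional:
  fixes p :: "'a::real_vector \<Rightarrow> real"
  assumes p: "sublinear_functional p"
  obtains u where "linear u" "u \<le> p"
proof -
  define \<S> where "\<S> = {q. sublinear_functional q \<and> q \<le> p}"
  have "\<exists>m\<in>\<S>. \<forall>q\<in>\<S>. q \<le> m \<longrightarrow> q = m"
  \<comment> \<open>The order is reversed, so that the maximal element obtained is a minimal
    functional.\<close>
  proof (rule predicate_Zorn[where P = "\<lambda>q r. r \<le> q"])
    show "partial_order_on \<S> (relation_of (\<lambda>q r. r \<le> q) \<S>)"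
      by (rule partial_order_on_relation_ofI) auto
  next
    fix \<A> assume \<A>: "\<A> \<in> Chains (relation_of (\<lambda>q r. r \<le> q) \<S>)"
    then have sub: "\<A> \<subseteq> \<S>" and chain: "\<And>q r. q \<in> \<A> \<Longrightarrow> r \<in> \<A> \<Longrightarrow> q \<le> r \<or> r \<le> q"
      by (auto simp: Chains_def relation_of_def)
    show "\<exists>u\<in>\<S>. \<forall>q\<in>\<A>. u \<le> q"
    proof (cases "\<A> = {}")
      case True
      then show ?thesis
        using p by (auto simp: \<S>_def)
    next
      case False
      \<comment> \<open>The bound \<open>- p (- x)\<close> is common to all functionals below
        \<open>p\<close>, so the pointwise infimum over the chain is finite.\<close>
      have bdd: "bdd_below ((\<lambda>q. q x) ` \<A>)" for x
      proof (rule bdd_belowI2)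
        fix q assume "q \<in> \<A>"
        then have "sublinear_functional q" "q (- x) \<le> p (- x)"
          using sub by (auto simp: \<S>_def le_fun_def)
        then show "- p (- x) \<le> q x"
          using sublinear_functional_minus[of q x] by simp
      qed
      define u where "u = (\<lambda>x. INF q\<in>\<A>. q x)"
      have u_le: "u \<le> q" if "q \<in> \<A>" for q
        unfolding u_def le_fun_def using that by (auto intro: cINF_lower bdd)
      have "sublinear_functional u"
        unfolding u_def using False sub chain bdd
        by (intro sublinear_functional_INF) (auto simp: \<S>_def)
      moreover obtain q where "q \<in> \<A>"
        using False by blast
      then have "u \<le> p"
        using u_le[of q] sub by (auto simp: \<S>_def)
      ultimately show ?thesis
        using u_le by (auto simp: \<S>_def)
    qed
  qed
  then obtain m where m: "sublinear_functional m" "m \<le> p"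
      and min: "\<And>q. sublinear_functional q \<Longrightarrow> q \<le> m \<Longrightarrow> q = m"
    by (auto simp: \<S>_def intro: order_trans)
  have minus: "m (- y) = - m y" for y
  proof -
    \<comment> \<open>Minimality forces \<open>q = m\<close>, hence
      \<open>m (- y) \<le> - m y\<close>; the reverse inequality holds for every sublinear
      functional.\<close>
    obtain q where "sublinear_functional q" "q \<le> m" "q (- y) \<le> - m y"
      using sublinear_functional_below[OF m(1)] by blast
    with min sublinear_functional_minus[OF m(1), of "- y"] show ?thesis
      by fastforce
  qed
  have scale: "m (r *\<^sub>R x) = r * m x" if "0 \<le> r" for r x
    using sublinear_functional_scale[OF m(1) that, of x]
      sublinear_functional_scale_ge[OF m(1) that, of x] by simp
  have "linear m"
  proof (rule linearI)
    fix x y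
    show "m (x + y) = m x + m y"
      using sublinear_functional_add[OF m(1), of x y] sublinear_functional_add[OF m(1), of "- x" "- y"]
        minus[of "x + y"] minus[of x] minus[of y] by simp
  next
    fix r :: real and x
    show "m (r *\<^sub>R x) = r *\<^sub>R m x"
      using scale[of r x] scale[of "- r" x] minus[of "r *\<^sub>R x"] by (cases "0 \<le> r") auto
  qed
  then show thesis
    using that m(2) by blast
qed

text \<open>The norm is first lowered to a \<open>q\<close> with
  \<open>q (- y) \<le> - norm y\<close>. Any linear functional below \<open>q\<close> then takes at
  least the value \<open>norm y\<close> at \<open>y\<close>, while staying below the norm.\<close>

lemma real_norming_functional:
  fixes y :: "'a::real_normed_vector"
  obtains u :: "'a \<Rightarrow> real" where "linear u" "\<And>x. u x \<le> norm x" "u y = norm y"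
proof -
  obtain q where q: "sublinear_functional q" "q \<le> norm" "q (- y) \<le> - norm y"
    using sublinear_functional_below[OF sublinear_functional_norm] by blast
  obtain u where u: "linear u" "u \<le> q"
    using linear_below_sublinear_functional[OF q(1)] by blast
  have le: "u x \<le> norm x" for x
    using u(2) q(2) by (meson le_funD order_trans)
  moreover have "u (- y) \<le> - norm y"
    using u(2) q(3) by (meson le_funD order_trans)
  then have "u y = norm y"
    using le[of y] linear_neg[OF u(1), of y] by simp
  ultimately show thesis
    using that u(1) by blast
qed

subsection \<open>Real and complex scalars at once\<close>

text \<open>The scalar field is viewed as a subfield of the complex plane, so that real parts,
  conjugates and the inner product are available in both cases; \<open>range\<close> records which
  case holds.\<close>

locale scalar_embedding =
  fixes T :: "'k::real_normed_field \<Rightarrow> complex"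
  assumes add: "T (x + y) = T x + T y"
    and scaleR: "T (r *\<^sub>R x) = r *\<^sub>R T x"
    and mult: "T (x * y) = T x * T y"
    and one: "T 1 = 1"
    and norm_eq: "norm (T x) = norm x"
    and range: "range T = \<real> \<or> range T = UNIV"
begin

lemma linear: "linear T"
  by (intro linearI add scaleR)

lemma bounded_linear: "bounded_linear T"
  by (rule bounded_linear_intro[where K = 1]) (simp_all add: add scaleR norm_eq)

lemma of_real: "T (of_real r) = of_real r"
  by (metis of_real_def one scaleR)

lemma norm_diff: "norm (T x - T y) = norm (x - y)"
  by (simp add: norm_eq flip: linear_diff[OF linear])

lemma inj: "T x = T y \<longleftrightarrow> x = y"
  using norm_diff[of x y] by auto

lemma tendsto_iff: "((\<lambda>n. T (x n)) \<longlongrightarrow> T l) F \<longleftrightarrow> (x \<longlongrightarrow> l) F"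
  unfolding tendsto_dist_iff[of _ "T l"] tendsto_dist_iff[of x] dist_norm norm_diff ..

text \<open>This lets a limit of values \<open>T (x n)\<close> in the plane be pulled back to a
  scalar.\<close>

lemma closed_range: "closed (range T)"
  using range closed_complex_Reals by auto

text \<open>The conjugate exists in any case, since it is \<open>|c|\<^sup>2 / c\<close>.\<close>

lemma obtain_cnj:
  obtains d where "T d = cnj (T c)"
proof (cases "c = 0")
  case True
  then have "T c = 0"
    using linear linear_0 by blast
  then show thesis
    using that[of c] by simp
next
  case False
  then have nz: "T c \<noteq> 0"
    using norm_eq[of c] by auto
  have "T (of_real ((norm c)\<^sup>2) * inverse c) * T c = of_real ((norm c)\<^sup>2)"
    using False by (simp del: of_real_power flip: mult add: of_real mult.assoc)
  also have "\<dots> = cnj (T c) * T c"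
    by (metis complex_norm_square mult.commute norm_eq)
  finally show thesis
    using that nz by simp
qed

end

lemma obtain_scalar_embedding:
  obtains T :: "'k::real_or_complex \<Rightarrow> complex" where "scalar_embedding T"
proof -
  note iso_real_or_complex[where 'a='k]
  then show thesis
  proof (elim disjE exE conjE)
    fix h :: "'k \<Rightarrow> real"
    assume h: "bij h" "h 1 = 1" "\<forall>x y. h (x + y) = h x + h y" "\<forall>x y. h (x * y) = h x * h y"
      "\<forall>r x. h (r *\<^sub>R x) = r *\<^sub>R h x" "\<forall>x. norm (h x) = norm x"
    have "range (\<lambda>x. complex_of_real (h x)) = \<real>"
      using bij_is_surj[OF h(1)] by (metis Reals_def image_image)
    with h have "scalar_embedding (\<lambda>x. complex_of_real (h x))"
      by unfold_locales (simp_all add: scaleR_conv_of_real[where 'a = complex])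
    then show thesis
      using that by blast
  next
    fix h :: "'k \<Rightarrow> complex"
    assume h: "bij h" "h 1 = 1" "\<forall>x y. h (x + y) = h x + h y" "\<forall>x y. h (x * y) = h x * h y"
      "\<forall>r x. h (r *\<^sub>R x) = r *\<^sub>R h x" "\<forall>x. norm (h x) = norm x"
    then have "scalar_embedding h"
      by unfold_locales (simp_all add: bij_is_surj)
    then show thesis
      using that by blast
  qed
qed

subsection \<open>Norming functionals\<close>

locale banach_space_over_embedded =
  banach_space_over smul + scalar_embedding T
  for smul :: "'k::real_or_complex \<Rightarrow> 'y::banach \<Rightarrow> 'y" and T :: "'k \<Rightarrow> complex"
begin

text \<open>Over the reals \<open>u\<close> itself serves. Over the complex numbers the real part
  determines the functional: comparing real parts at \<open>smul j x\<close> shows that the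
  imaginary part must be \<open>- u (smul j x)\<close>.\<close>

lemma linear_functional_with_real_part:
  assumes u: "linear u"
  obtains \<phi> where "linear \<phi>" "\<And>c x. \<phi> (smul c x) = c * \<phi> x" "\<And>x. Re (T (\<phi> x)) = u x"
proof (cases "range T = \<real>")
  case True
  have T_real: "c = of_real (Re (T c))" for c
  proof -
    have "T c \<in> \<real>"
      using True by blast
    then have "T c = T (of_real (Re (T c)))"
      by (simp add: of_real)
    then show ?thesis
      by (simp add: inj)
  qed
  show thesis
  proof (rule that)
    show "linear (\<lambda>x. of_real (u x) :: 'k)"
      by (rule linearI) (simp_all add: linear_add[OF u] linear_scale[OF u] scaleR_conv_of_real)
    show "of_real (u (smul c x)) = c * of_real (u x)" for c x
      by (subst (1 2) T_real[of c]) (simp add: smul_of_real linear_scale[OF u])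
    show "Re (T (of_real (u x))) = u x" for x
      by (simp add: of_real)
  qed
next
  case False
  then have "surj T"
    using range by blast
  \<comment> \<open>\<open>j\<close> is the imaginary unit of the scalar field.\<close>
  then obtain j where j: "T j = \<i>"
    by (metis surjD)
  have jj: "j * j = -1"
    by (metis inj j linear linear_neg mult one i_squared power2_eq_square)
  have T_complex: "c = of_real (Re (T c)) + of_real (Im (T c)) * j" for c
  proof -
    have "T c = T (of_real (Re (T c)) + of_real (Im (T c)) * j)"
      by (simp add: add mult of_real j complex_eq_iff)
    then show ?thesis
      by (simp add: inj)
  qed
  define \<phi> where "\<phi> = (\<lambda>x. of_real (u x) - j * of_real (u (smul j x)))"
  have smul_j_scaleR: "smul j (r *\<^sub>R x) = r *\<^sub>R smul j x" for r x
    by (metis mult.commute scale_scale smul_of_real)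
  have lin: "linear \<phi>"
    by (rule linearI)
      (simp_all add: \<phi>_def linear_add[OF u] linear_scale[OF u] scaleR_conv_of_real
        scale_right_distrib smul_j_scaleR algebra_simps flip: of_real_mult)
  have mult_j: "\<phi> (smul j x) = j * \<phi> x" for x
  proof -
    have "u (smul j (smul j x)) = - u x"
      using jj linear_neg[OF u, of x] by simp
    moreover have "j * (j * a) = - a" for a
      using jj by (metis mult.assoc mult_minus1)
    ultimately show ?thesis
      by (simp add: \<phi>_def right_diff_distrib)
  qed
  show thesis
  proof (rule that[OF lin])
    fix c x
    \<comment> \<open>Splitting \<open>c\<close> into real and imaginary parts reduces homogeneity
      to real scalars and to \<open>j\<close>.\<close>
    define a b where "a = Re (T c)" and "b = Im (T c)"
    have c: "c = of_real a + of_real b * j"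
      unfolding a_def b_def by (rule T_complex)
    have "\<phi> (smul c x) = \<phi> (a *\<^sub>R x + b *\<^sub>R smul j x)"
      unfolding c by (metis scale_left_distrib scale_scale smul_of_real)
    also have "\<dots> = a *\<^sub>R \<phi> x + b *\<^sub>R (j * \<phi> x)"
      by (simp add: linear_add[OF lin] linear_scale[OF lin] mult_j)
    also have "\<dots> = c * \<phi> x"
      unfolding c by (simp add: scaleR_conv_of_real algebra_simps)
    finally show "\<phi> (smul c x) = c * \<phi> x" .
  next
    fix x
    show "Re (T (\<phi> x)) = u x"
      unfolding \<phi>_def by (simp add: linear_diff[OF linear] mult of_real j)
  qed
qed

lemma norming_functional:
  obtains \<phi> where "\<phi> \<in> dual_ball smul" "Re (T (blinfun_apply \<phi> y)) = norm y"
proof -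
  obtain u :: "'y \<Rightarrow> real" where u: "linear u" "\<And>x. u x \<le> norm x" "u y = norm y"
    using real_norming_functional by blast
  obtain \<psi> where \<psi>: "linear \<psi>" "\<And>c x. \<psi> (smul c x) = c * \<psi> x" "\<And>x. Re (T (\<psi> x)) = u x"
    using linear_functional_with_real_part[OF u(1)] by blast
  have le: "norm (\<psi> x) \<le> norm x" for x
  proof (cases "\<psi> x = 0")
    case False
    \<comment> \<open>This unimodular factor rotates \<open>\<psi> x\<close> onto its modulus, so
      the bound on the real part becomes a bound on the modulus.\<close>
    define c where "c = of_real (norm (\<psi> x)) / \<psi> x"
    have "norm (\<psi> x) = Re (T (c * \<psi> x))"
      using False by (simp add: c_def of_real)
    also have "\<dots> = u (smul c x)"
      by (simp only: \<psi>(2)[symmetric] \<psi>(3))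
    also have "\<dots> \<le> norm c * norm x"
      using u(2)[of "smul c x"] by (simp add: norm_smul)
    also have "norm c = 1"
      using False by (simp add: c_def norm_divide)
    finally show ?thesis
      by simp
  qed simp
  have bl: "bounded_linear \<psi>"
    using \<psi>(1) le by (intro bounded_linear_intro[where K = 1]) (simp_all add: linear_add linear_scale)
  show thesis
  proof (rule that)
    show "Blinfun \<psi> \<in> dual_ball smul"
      using bl \<psi>(2) le norm_blinfun_bound[of 1 "Blinfun \<psi>"]
      by (simp add: dual_ball_def dual_space_def bounded_linear_Blinfun_apply)
    show "Re (T (blinfun_apply (Blinfun \<psi>) y)) = norm y"
      using bl \<psi>(3) u(3) by (simp add: bounded_linear_Blinfun_apply)
  qed
qed

text \<open>A norming functional lies in the weak-star open set where the real part at
  \<open>y\<close> exceeds \<open>b\<close>, so this set meets the convex hull of \<open>C\<close>.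
  It must then meet \<open>C\<close>, since the complementary half-space is convex.\<close>

lemma norming_subset:
  assumes C: "dual_ball smul \<subseteq> weak_star_topology smul closure_of (convex hull C)"
    and "b < norm y"
  obtains \<phi> where "\<phi> \<in> C" "b < Re (T (blinfun_apply \<phi> y))"
proof -
  obtain \<psi> where \<psi>: "\<psi> \<in> dual_ball smul" "Re (T (blinfun_apply \<psi> y)) = norm y"
    using norming_functional by blast
  \<comment> \<open>\<open>V\<close> lives in the product space, from which the weak-star topology
    is pulled back; there evaluation at \<open>y\<close> is continuous.\<close>
  define V where "V = {F :: 'y \<Rightarrow> 'k. b < Re (T (F y))}"
  have cont: "continuous_on UNIV (\<lambda>F :: 'y \<Rightarrow> 'k. Re (T (F y)))"
    by (intro continuous_intros bounded_linear.continuous_on[OF bounded_linear]) simp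
  then have "open V"
    unfolding V_def by (rule open_Collect_less[OF continuous_on_const])
  then have "openin (weak_star_topology smul) (blinfun_apply -` V \<inter> dual_space smul)"
    unfolding weak_star_topology_def by (auto simp: openin_pullback_topology)
  moreover have "\<psi> \<in> blinfun_apply -` V \<inter> dual_space smul"
    using \<psi> \<open>b < norm y\<close> by (simp add: V_def dual_ball_def)
  moreover have "\<psi> \<in> weak_star_topology smul closure_of (convex hull C)"
    using C \<psi>(1) by blast
  ultimately obtain \<eta> where "\<eta> \<in> convex hull C" "\<eta> \<in> blinfun_apply -` V \<inter> dual_space smul"
    by (meson in_closure_of)
  then have \<eta>: "\<eta> \<in> convex hull C" "b < Re (T (blinfun_apply \<eta> y))"
    by (simp_all add: V_def)
  have "\<not> C \<subseteq> {\<phi>. Re (T (blinfun_apply \<phi> y)) \<le> b}"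
  proof
    assume "C \<subseteq> {\<phi>. Re (T (blinfun_apply \<phi> y)) \<le> b}"
    moreover have "linear (\<lambda>\<phi>. Re (T (blinfun_apply \<phi> y)))"
      by (rule linearI) (simp_all add: blinfun.add_left blinfun.scaleR_left add scaleR)
    then have "convex {\<phi>. Re (T (blinfun_apply \<phi> y)) \<le> b}"
      using convex_linear_vimage[of _ "{..b}"] by (fastforce simp: vimage_def)
    ultimately have "convex hull C \<subseteq> {\<phi>. Re (T (blinfun_apply \<phi> y)) \<le> b}"
      by (rule hull_minimal)
    with \<eta> show False
      by auto
  qed
  then show thesis
    using that by (fastforce simp: not_le[symmetric])
qed

end

subsection \<open>The set of limits\<close>

lemma norm_le_linf_norm: "f \<in> linf \<Gamma> \<Longrightarrow> \<gamma> \<in> \<Gamma> \<Longrightarrow> norm (f \<gamma>) \<le> linf_norm \<Gamma> f"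
  unfolding linf_def linf_norm_def
  by (intro cSUP_upper) (auto simp: bdd_above_norm image_image[symmetric])

lemma less_linf_norm_iff:
  assumes "f \<in> linf \<Gamma>" "\<Gamma> \<noteq> {}"
  shows "b < linf_norm \<Gamma> f \<longleftrightarrow> (\<exists>\<gamma>\<in>\<Gamma>. b < norm (f \<gamma>))"
  using assms unfolding linf_def linf_norm_def
  by (intro less_cSUP_iff) (auto simp: bdd_above_norm image_image[symmetric])

text \<open>This is the set \<open>D\<close> of the overview, written as in the theorem.\<close>

definition peak_limits :: "'g set \<Rightarrow> ('y::real_normed_vector \<Rightarrow>\<^sub>L 'k::real_normed_field) set
    \<Rightarrow> ('g \<Rightarrow> 'y) \<Rightarrow> ('g \<Rightarrow> 'y) \<Rightarrow> 'k set"
  where "peak_limits \<Gamma> C f g = {l. \<exists>(\<gamma> :: nat \<Rightarrow> 'g) (\<phi> :: nat \<Rightarrow> 'y \<Rightarrow>\<^sub>L 'k).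
        (\<forall>n. \<gamma> n \<in> \<Gamma> \<and> \<phi> n \<in> C)
        \<and> (\<lambda>n. blinfun_apply (\<phi> n) (f (\<gamma> n))) \<longlonglongrightarrow> of_real (linf_norm \<Gamma> f)
        \<and> (\<lambda>n. blinfun_apply (\<phi> n) (g (\<gamma> n))) \<longlonglongrightarrow> l}"

text \<open>The limits form a slice of the closure of the joint range of both evaluations, because
  closure points are sequential limits. Closedness then follows without a diagonal argument.\<close>

lemma peak_limits_eq_closure:
  "peak_limits \<Gamma> C f g = Pair (of_real (linf_norm \<Gamma> f)) -`
    closure ((\<lambda>(\<gamma>, \<phi>). (blinfun_apply \<phi> (f \<gamma>), blinfun_apply \<phi> (g \<gamma>))) ` (\<Gamma> \<times> C))"
  (is "_ = Pair ?N -` closure ?S")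
proof (intro set_eqI iffI)
  fix l assume "l \<in> peak_limits \<Gamma> C f g"
  then obtain \<gamma> \<phi> where "\<forall>n. \<gamma> n \<in> \<Gamma> \<and> \<phi> n \<in> C"
    "(\<lambda>n. blinfun_apply (\<phi> n) (f (\<gamma> n))) \<longlonglongrightarrow> ?N" "(\<lambda>n. blinfun_apply (\<phi> n) (g (\<gamma> n))) \<longlonglongrightarrow> l"
    by (auto simp: peak_limits_def)
  then show "l \<in> Pair ?N -` closure ?S"
    unfolding vimage_eq closure_sequential
    by (intro exI[of _ "\<lambda>n. (blinfun_apply (\<phi> n) (f (\<gamma> n)), blinfun_apply (\<phi> n) (g (\<gamma> n)))"])
      (force intro: tendsto_Pair)
next
  fix l assume "l \<in> Pair ?N -` closure ?S"
  then obtain z where z: "\<forall>n. z n \<in> ?S" and lim: "z \<longlonglongrightarrow> (?N, l)"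
    by (auto simp: closure_sequential)
  from z have "\<forall>n. \<exists>\<gamma> \<phi>. \<gamma> \<in> \<Gamma> \<and> \<phi> \<in> C \<and> z n = (blinfun_apply \<phi> (f \<gamma>), blinfun_apply \<phi> (g \<gamma>))"
    by fast
  then obtain \<gamma> \<phi> where "\<And>n. \<gamma> n \<in> \<Gamma> \<and> \<phi> n \<in> C"
    and zn: "\<And>n. z n = (blinfun_apply (\<phi> n) (f (\<gamma> n)), blinfun_apply (\<phi> n) (g (\<gamma> n)))"
    by metis
  moreover have "(\<lambda>n. blinfun_apply (\<phi> n) (f (\<gamma> n))) \<longlonglongrightarrow> ?N"
    using tendsto_fst[OF lim] by (simp add: zn)
  moreover have "(\<lambda>n. blinfun_apply (\<phi> n) (g (\<gamma> n))) \<longlonglongrightarrow> l"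
    using tendsto_snd[OF lim] by (simp add: zn)
  ultimately show "l \<in> peak_limits \<Gamma> C f g"
    unfolding peak_limits_def by blast
qed

lemma closed_peak_limits: "closed (peak_limits \<Gamma> C f g)"
  unfolding peak_limits_eq_closure by (intro closed_vimage closed_closure continuous_intros)

text \<open>Expanding the square shows that in the disc of radius \<open>r\<close> a real part close
  to \<open>r\<close> forces the whole number to be close to \<open>r\<close>. This upgrades
  convergence of real parts to convergence of values.\<close>

lemma norm_diff_of_real_sq_le:
  assumes "norm z \<le> r"
  shows "(norm (z - of_real r))\<^sup>2 \<le> 2 * r * (r - Re z)"
proof -
  have "(norm (z - of_real r))\<^sup>2 = (norm z)\<^sup>2 - 2 * r * Re z + r\<^sup>2"
    by (simp add: cmod_power2) (simp add: power2_eq_square algebra_simps)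
  also have "(norm z)\<^sup>2 \<le> r\<^sup>2"
    using assms by (simp add: power_mono)
  finally show ?thesis
    by (simp add: power2_eq_square algebra_simps)
qed

section \<open>Limits along a norming subset of the dual sphere\<close>

locale norming_set = banach_space_over_embedded smul T
  for smul :: "'k::real_or_complex \<Rightarrow> 'y::banach \<Rightarrow> 'y" and T :: "'k \<Rightarrow> complex" +
  fixes C :: "('y \<Rightarrow>\<^sub>L 'k) set"
  assumes C_sphere: "C \<subseteq> dual_sphere smul"
    and C_dense: "dual_ball smul \<subseteq> weak_star_topology smul closure_of (convex hull C)"
begin

lemma norm_apply_le: "\<phi> \<in> C \<Longrightarrow> norm (blinfun_apply \<phi> y) \<le> norm y"
  using C_sphere norm_blinfun[of \<phi> y] by (auto simp: dual_sphere_def)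

lemma norm_apply_le_linf_norm:
  assumes "f \<in> linf \<Gamma>" "\<phi> \<in> C" "\<gamma> \<in> \<Gamma>"
  shows "norm (blinfun_apply \<phi> (f \<gamma>)) \<le> linf_norm \<Gamma> f"
  using norm_apply_le[OF assms(2)] norm_le_linf_norm[OF assms(1,3)] by (rule order_trans)

lemma apply_smul: "\<phi> \<in> C \<Longrightarrow> blinfun_apply \<phi> (smul c y) = c * blinfun_apply \<phi> y"
  using C_sphere by (auto simp: dual_sphere_def dual_space_def)

lemma add_linf_smul:
  assumes "f \<in> linf \<Gamma>" "g \<in> linf \<Gamma>"
  shows "f + linf_smul smul c g \<in> linf \<Gamma>"
proof -
  have "norm ((f + linf_smul smul c g) \<gamma>) \<le> linf_norm \<Gamma> f + norm c * linf_norm \<Gamma> g"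
    if "\<gamma> \<in> \<Gamma>" for \<gamma>
  proof -
    have "norm ((f + linf_smul smul c g) \<gamma>) \<le> norm (f \<gamma>) + norm c * norm (g \<gamma>)"
      by (metis linf_smul_def norm_smul norm_triangle_ineq plus_fun_apply)
    also have "\<dots> \<le> linf_norm \<Gamma> f + norm c * linf_norm \<Gamma> g"
      using assms that by (intro add_mono mult_left_mono norm_le_linf_norm) auto
    finally show ?thesis .
  qed
  then show ?thesis
    by (auto simp: linf_def bounded_iff)
qed

text \<open>The image under \<open>T\<close> lies in the plane, where closed and bounded sets are
  compact. The norm of \<open>g\<close> bounds all limits; closedness transfers because
  \<open>T\<close> is isometric with closed range.\<close>

lemma compact_image_peak_limits:
  assumes g: "g \<in> linf \<Gamma>"
  shows "compact (T ` peak_limits \<Gamma> C f g)"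
proof -
  have "norm l \<le> linf_norm \<Gamma> g" if l: "l \<in> peak_limits \<Gamma> C f g" for l
  proof -
    obtain \<gamma> \<phi> where *: "\<And>n. \<gamma> n \<in> \<Gamma> \<and> \<phi> n \<in> C" "(\<lambda>n. blinfun_apply (\<phi> n) (g (\<gamma> n))) \<longlonglongrightarrow> l"
      using l unfolding peak_limits_def by blast
    have "norm (blinfun_apply (\<phi> n) (g (\<gamma> n))) \<le> linf_norm \<Gamma> g" for n
      using norm_apply_le_linf_norm[OF g] *(1) by blast
    then show ?thesis
      using *(2) by (intro Lim_norm_ubound[OF _ *(2)]) auto
  qed
  then have "bounded (T ` peak_limits \<Gamma> C f g)"
    by (auto simp: bounded_iff norm_eq)
  moreover have "closed (T ` peak_limits \<Gamma> C f g)"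
    unfolding closed_sequential_limits
  proof (intro allI impI, elim conjE)
    fix z l assume z: "\<forall>n. z n \<in> T ` peak_limits \<Gamma> C f g" and lim: "z \<longlonglongrightarrow> l"
    from z obtain x where x: "\<And>n. x n \<in> peak_limits \<Gamma> C f g" "z = (\<lambda>n. T (x n))"
      unfolding image_iff by metis
    have "l \<in> range T"
      by (rule closed_sequentially[OF closed_range _ lim]) (simp add: x(2))
    then obtain k where k: "l = T k"
      by blast
    then have "x \<longlonglongrightarrow> k"
      using lim by (simp only: x(2) k tendsto_iff)
    then have "k \<in> peak_limits \<Gamma> C f g"
      using closed_peak_limits x(1) closed_sequential_limits by blast
    then show "l \<in> T ` peak_limits \<Gamma> C f g"
      using k by blast
  qed
  ultimately show ?thesis
    by (simp add: compact_eq_bounded_closed)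
qed

text \<open>Orthogonality is used only for the small multiples \<open>of_real (t n) * c\<close>, and
  near-maximal values of the perturbed functions are tested with elements of
  \<open>C\<close>.\<close>

lemma peak_limits_half_plane_nonneg:
  assumes ne: "\<Gamma> \<noteq> {}" and f: "f \<in> linf \<Gamma>" and g: "g \<in> linf \<Gamma>"
    and orth: "birkhoff_james_orthogonal (linf_norm \<Gamma>) (linf_smul smul) f g"
  shows "\<exists>l\<in>peak_limits \<Gamma> C f g. 0 \<le> Re (T (c * l))"
proof -
  define N G where "N = linf_norm \<Gamma> f" and "G = linf_norm \<Gamma> g"
  define t :: "nat \<Rightarrow> real" where "t n = inverse (real (Suc n))" for n
  have t_pos: "0 < t n" for n
    by (simp add: t_def)
  have t_lim: "t \<longlonglongrightarrow> 0"
    unfolding t_def by (rule LIMSEQ_inverse_real_of_nat)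
  \<comment> \<open>The permitted error is the square of the perturbation size, so that after
    division by \<open>t n\<close> it still tends to zero.\<close>
  have "\<exists>\<gamma> \<phi>. \<gamma> \<in> \<Gamma> \<and> \<phi> \<in> C \<and> N - (t n)\<^sup>2 <
      Re (T (blinfun_apply \<phi> ((f + linf_smul smul (of_real (t n) * c) g) \<gamma>)))" for n
  proof -
    have "N \<le> linf_norm \<Gamma> (f + linf_smul smul (of_real (t n) * c) g)"
      using orth by (simp add: birkhoff_james_orthogonal_def N_def)
    moreover have "0 < (t n)\<^sup>2"
      using t_pos[of n] by simp
    ultimately have "N - (t n)\<^sup>2 < linf_norm \<Gamma> (f + linf_smul smul (of_real (t n) * c) g)"
      by linarith
    then obtain \<gamma> where "\<gamma> \<in> \<Gamma>" "N - (t n)\<^sup>2 < norm ((f + linf_smul smul (of_real (t n) * c) g) \<gamma>)"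
      using less_linf_norm_iff[OF add_linf_smul[OF f g] ne] by blast
    then show ?thesis
      using norming_subset[OF C_dense] by metis
  qed
  then obtain \<gamma> \<phi> where in_dom: "\<And>n. \<gamma> n \<in> \<Gamma>" "\<And>n. \<phi> n \<in> C"
    and large: "\<And>n. N - (t n)\<^sup>2 <
      Re (T (blinfun_apply (\<phi> n) ((f + linf_smul smul (of_real (t n) * c) g) (\<gamma> n))))"
    by metis
  define a b where "a n = blinfun_apply (\<phi> n) (f (\<gamma> n))" and "b n = blinfun_apply (\<phi> n) (g (\<gamma> n))"
    for n
  have a_le: "norm (a n) \<le> N" and b_le: "norm (b n) \<le> G" for n
    unfolding a_def b_def N_def G_def by (intro norm_apply_le_linf_norm f g in_dom)+
  have large': "N - (t n)\<^sup>2 < Re (T (a n)) + t n * Re (T (c * b n))" for n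
    using large[of n]
    by (simp add: linf_smul_def blinfun.add_right apply_smul in_dom a_def b_def add mult of_real)
      (simp add: algebra_simps)
  have Re_b: "- t n < Re (T (c * b n))" for n
  proof -
    have "Re (T (a n)) \<le> N"
      using complex_Re_le_cmod[of "T (a n)"] a_le[of n] by (simp add: norm_eq)
    with large'[of n] have "t n * (- t n) < t n * Re (T (c * b n))"
      by (simp add: power2_eq_square)
    then show ?thesis
      using t_pos[of n] by (simp only: mult_less_cancel_left_pos)
  qed
  have "a \<longlonglongrightarrow> of_real N"
  proof -
    \<comment> \<open>The perturbation term is at most \<open>t n * (norm c * G)\<close>, so
      \<open>large'\<close> makes \<open>Re (T (a n))\<close> approach \<open>N\<close>; the disc
      estimate converts this into distance from \<open>N\<close>.\<close>
    have le: "(norm (T (a n) - of_real N))\<^sup>2 \<le> 2 * N * ((t n)\<^sup>2 + t n * (norm c * G))" for n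
    proof -
      have "Re (T (c * b n)) \<le> norm c * norm (b n)"
        using complex_Re_le_cmod[of "T (c * b n)"] by (simp only: norm_eq norm_mult)
      also have "\<dots> \<le> norm c * G"
        using b_le by (simp add: mult_left_mono)
      finally have "t n * Re (T (c * b n)) \<le> t n * (norm c * G)"
        using t_pos[of n] by (intro mult_left_mono) auto
      with large'[of n] have "N - Re (T (a n)) \<le> (t n)\<^sup>2 + t n * (norm c * G)"
        by simp
      moreover have "0 \<le> N"
        using a_le[of n] norm_ge_zero order_trans by blast
      ultimately have "2 * N * (N - Re (T (a n))) \<le> 2 * N * ((t n)\<^sup>2 + t n * (norm c * G))"
        by (intro mult_left_mono) auto
      then show ?thesis
        using norm_diff_of_real_sq_le[of "T (a n)" N] a_le[of n] by (simp add: norm_eq)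
    qed
    have "(\<lambda>n. 2 * N * ((t n)\<^sup>2 + t n * (norm c * G))) \<longlonglongrightarrow> 2 * N * (0\<^sup>2 + 0 * (norm c * G))"
      by (intro tendsto_intros t_lim)
    then have "(\<lambda>n. 2 * N * ((t n)\<^sup>2 + t n * (norm c * G))) \<longlonglongrightarrow> 0"
      by simp
    then have "(\<lambda>n. (norm (T (a n) - of_real N))\<^sup>2) \<longlonglongrightarrow> 0"
      by (rule tendsto_sandwich[rotated 2, OF tendsto_const]) (use le in auto)
    then have "(\<lambda>n. T (a n) - of_real N) \<longlonglongrightarrow> 0"
      by (simp add: tendsto_norm_zero_iff)
    then have "(\<lambda>n. T (a n)) \<longlonglongrightarrow> T (of_real N)"
      by (simp add: of_real Lim_null[symmetric])
    then show ?thesis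
      by (simp add: tendsto_iff)
  qed
  \<comment> \<open>The values \<open>b n\<close> are only bounded, so a convergent subsequence is
    chosen; the limit of \<open>a\<close> is unaffected.\<close>
  have "bounded (range (\<lambda>n. T (b n)))"
    using b_le by (auto simp: bounded_iff norm_eq)
  then obtain z r where r: "strict_mono r" and z: "((\<lambda>n. T (b n)) \<circ> r) \<longlonglongrightarrow> z"
    using bounded_imp_convergent_subsequence by blast
  have "z \<in> range T"
    by (rule closed_sequentially[OF closed_range _ z]) simp
  then obtain l where l: "z = T l"
    by blast
  then have b_lim: "(\<lambda>n. b (r n)) \<longlonglongrightarrow> l"
    using z by (simp add: o_def tendsto_iff)
  have "(\<lambda>n. a (r n)) \<longlonglongrightarrow> of_real N"
    using LIMSEQ_subseq_LIMSEQ[OF \<open>a \<longlonglongrightarrow> of_real N\<close> r] by (simp add: o_def)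
  with b_lim in_dom have "l \<in> peak_limits \<Gamma> C f g"
    unfolding peak_limits_def a_def b_def N_def
    by (intro CollectI exI[of _ "\<lambda>n. \<gamma> (r n)"] exI[of _ "\<lambda>n. \<phi> (r n)"]) auto
  moreover have "0 \<le> Re (T (c * l))"
  proof (rule LIMSEQ_le)
    show "(\<lambda>n. - t (r n)) \<longlonglongrightarrow> 0"
      using tendsto_minus[OF LIMSEQ_subseq_LIMSEQ[OF t_lim r]] by (simp add: o_def)
    show "(\<lambda>n. Re (T (c * b (r n)))) \<longlonglongrightarrow> Re (T (c * l))"
      by (intro tendsto_intros bounded_linear.tendsto[OF bounded_linear] b_lim)
    show "\<exists>m. \<forall>n\<ge>m. - t (r n) \<le> Re (T (c * b (r n)))"
      using Re_b less_imp_le by blast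
  qed
  ultimately show ?thesis
    by blast
qed

section \<open>The two implications\<close>

lemma orthogonal_imp_zero_in_hull:
  assumes ne: "\<Gamma> \<noteq> {}" and f: "f \<in> linf \<Gamma>" and g: "g \<in> linf \<Gamma>"
    and orth: "birkhoff_james_orthogonal (linf_norm \<Gamma>) (linf_smul smul) f g"
  shows "0 \<in> convex hull peak_limits \<Gamma> C f g"
proof (rule ccontr)
  let ?D = "peak_limits \<Gamma> C f g"
  assume "0 \<notin> convex hull ?D"
  have hull: "convex hull (T ` ?D) = T ` (convex hull ?D)"
    by (simp add: convex_hull_linear_image[OF linear])
  have "0 \<notin> convex hull (T ` ?D)"
    using \<open>0 \<notin> convex hull ?D\<close> linear_0[OF linear] inj unfolding hull by (metis imageE)
  moreover have "?D \<noteq> {}"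
    using peak_limits_half_plane_nonneg[OF assms] by blast
  moreover have "closed (convex hull (T ` ?D))"
    by (simp add: compact_imp_closed compact_convex_hull compact_image_peak_limits[OF g])
  \<comment> \<open>The normal vector \<open>a\<close> is taken inside the hull itself, hence in the
    range of \<open>T\<close>; over the reals this makes it a real number.\<close>
  ultimately obtain a b where ab: "a \<in> convex hull (T ` ?D)" "0 < b"
      "\<And>x. x \<in> convex hull (T ` ?D) \<Longrightarrow> b < a \<bullet> x"
    using separating_hyperplane_closed_0_inset[of "convex hull (T ` ?D)"] convex_convex_hull
    by (metis convex_hull_eq_empty image_is_empty)
  obtain k where k: "a = T k"
    using ab(1) unfolding hull by blast
  obtain d where d: "T d = cnj a"
    using obtain_cnj[of k] k by blast
  \<comment> \<open>The inner product with \<open>a\<close> is the real part of multiplication by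
    \<open>cnj a\<close>, so the scalar \<open>- d\<close> picks a limit on the wrong side of the
    separating line.\<close>
  obtain l where l: "l \<in> ?D" "0 \<le> Re (T (- d * l))"
    using peak_limits_half_plane_nonneg[OF assms] by blast
  have "Re (T (- d * l)) = - (a \<bullet> T l)"
    by (simp add: mult linear_neg[OF linear] d inner_complex_def)
  moreover have "b < a \<bullet> T l"
    using l(1) by (intro ab(3) hull_inc) blast
  ultimately show False
    using l(2) ab(2) by linarith
qed

lemma zero_in_hull_imp_orthogonal:
  assumes f: "f \<in> linf \<Gamma>" and g: "g \<in> linf \<Gamma>"
    and zero: "0 \<in> convex hull peak_limits \<Gamma> C f g"
  shows "birkhoff_james_orthogonal (linf_norm \<Gamma>) (linf_smul smul) f g"
  unfolding birkhoff_james_orthogonal_def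
proof
  fix c
  define N M where "N = linf_norm \<Gamma> f" and "M = linf_norm \<Gamma> (f + linf_smul smul c g)"
  have "peak_limits \<Gamma> C f g \<subseteq> {l. Re (T (c * l)) \<le> M - N}"
  proof
    fix l assume "l \<in> peak_limits \<Gamma> C f g"
    then obtain \<gamma> \<phi> where in_dom: "\<And>n. \<gamma> n \<in> \<Gamma>" "\<And>n. \<phi> n \<in> C"
      and lim: "(\<lambda>n. blinfun_apply (\<phi> n) (f (\<gamma> n))) \<longlonglongrightarrow> of_real N"
        "(\<lambda>n. blinfun_apply (\<phi> n) (g (\<gamma> n))) \<longlonglongrightarrow> l"
      by (auto simp: peak_limits_def N_def)
    \<comment> \<open>Each \<open>\<phi> n\<close> has norm one and, applied to the perturbed
      function, is bounded by \<open>M\<close>; the bound passes to the limit.\<close>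
    have "norm (of_real N + c * l) \<le> M"
    proof (rule Lim_norm_ubound)
      show "(\<lambda>n. blinfun_apply (\<phi> n) (f (\<gamma> n)) + c * blinfun_apply (\<phi> n) (g (\<gamma> n)))
          \<longlonglongrightarrow> of_real N + c * l"
        by (intro tendsto_intros lim)
      have "norm (blinfun_apply (\<phi> n) (f (\<gamma> n)) + c * blinfun_apply (\<phi> n) (g (\<gamma> n))) \<le> M" for n
      proof -
        have "norm (blinfun_apply (\<phi> n) ((f + linf_smul smul c g) (\<gamma> n))) \<le> M"
          unfolding M_def by (intro norm_apply_le_linf_norm add_linf_smul f g in_dom)
        then show ?thesis
          by (simp add: linf_smul_def blinfun.add_right apply_smul in_dom)
      qed
      then show "\<forall>\<^sub>F n in sequentially.
          norm (blinfun_apply (\<phi> n) (f (\<gamma> n)) + c * blinfun_apply (\<phi> n) (g (\<gamma> n))) \<le> M"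
        by simp
    qed simp
    then have "Re (T (of_real N + c * l)) \<le> M"
      using complex_Re_le_cmod norm_eq order_trans by metis
    then show "l \<in> {l. Re (T (c * l)) \<le> M - N}"
      by (simp add: add of_real)
  qed
  moreover have "linear (\<lambda>l. Re (T (c * l)))"
    by (rule linearI) (simp_all add: add scaleR distrib_left)
  then have "convex {l. Re (T (c * l)) \<le> M - N}"
    using convex_linear_vimage[of _ "{..M - N}"] by (fastforce simp: vimage_def)
  ultimately have "convex hull peak_limits \<Gamma> C f g \<subseteq> {l. Re (T (c * l)) \<le> M - N}"
    by (rule hull_minimal)
  \<comment> \<open>At zero the half-plane condition reads \<open>0 \<le> M - N\<close>, the
    orthogonality inequality for \<open>c\<close>.\<close>
  then have "Re (T (c * 0)) \<le> M - N"
    using zero by blast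
  then show "linf_norm \<Gamma> f \<le> linf_norm \<Gamma> (f + linf_smul smul c g)"
    using linear_0[OF linear] by (simp add: M_def N_def)
qed

end

theorem theorem3p2:
  fixes smul :: "'k::real_or_complex \<Rightarrow> 'y::banach \<Rightarrow> 'y"
    and \<Gamma> :: "'g set"
    and C :: "('y \<Rightarrow>\<^sub>L 'k) set"
    and f g :: "'g \<Rightarrow> 'y"
  assumes "\<Gamma> \<noteq> {}"
    and "banach_space_over smul"
    and "C \<subseteq> dual_sphere smul"
    and "dual_ball smul = weak_star_topology smul closure_of (convex hull C)"
    and "f \<in> linf \<Gamma>" and "g \<in> linf \<Gamma>"
  shows "birkhoff_james_orthogonal (linf_norm \<Gamma>) (linf_smul smul) f g \<longleftrightarrow>
    0 \<in> convex hull {l :: 'k. \<exists>(\<gamma> :: nat \<Rightarrow> 'g) (\<phi> :: nat \<Rightarrow> 'y \<Rightarrow>\<^sub>L 'k).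
        (\<forall>n. \<gamma> n \<in> \<Gamma> \<and> \<phi> n \<in> C)
        \<and> (\<lambda>n. blinfun_apply (\<phi> n) (f (\<gamma> n))) \<longlonglongrightarrow> of_real (linf_norm \<Gamma> f)
        \<and> (\<lambda>n. blinfun_apply (\<phi> n) (g (\<gamma> n))) \<longlonglongrightarrow> l}"
proof -
  \<comment> \<open>The embedding is auxiliary and does not occur in the conclusion, so any choice
    will do.\<close>
  obtain T :: "'k \<Rightarrow> complex" where "scalar_embedding T"
    using obtain_scalar_embedding by blast
  then interpret norming_set smul T C
    using assms(2-4)
    by (simp add: norming_set_def banach_space_over_embedded_def norming_set_axioms_def)
  show ?thesis
    using orthogonal_imp_zero_in_hull[OF assms(1,5,6)] zero_in_hull_imp_orthogonal[OF assms(5,6)]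
    unfolding peak_limits_def by blast
qed

end
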